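(* Let $K$ be a field of characteristic zero and let $\mathfrak{g}$ be a finite-dimensional nilpotent Lie algebra over $K$ with a CPA-structure, with left multiplication map $L\colon\mathfrak{g}\to\mathrm{Der}(\mathfrak{g})$, $L(x)(y)=x\cdot y$. Let $\mathfrak{a}\subseteq\mathfrak{g}^t$ be a characteristic ideal of $\mathfrak{g}$ contained in the lower central series ideal $\mathfrak{g}^t$, and let $r=\left\lceil\frac{\dim(\mathfrak{a})+t-1}{t}\right\rceil$. Then $$L(\mathfrak{a})^r(\mathfrak{g})=0.$$ In particular, if $\mathfrak{g}$ is a nilpotent stem Lie algebra, i.e. satisfies $Z(\mathfrak{g})\subseteq\mathfrak{g}^2=[\mathfrak{g},\mathfrak{g}]$, then (taking $\mathfrak{a}=Z(\mathfrak{g})$, $t=2$) we have $r=\left\lceil\frac{\dim Z(\mathfrak{g})+1}{2}\right\rceil$ and $L(Z(\mathfrak{g}))^r(\mathfrak{g})=0$. This gives $L(Z(\mathfrak{g}))(\mathfrak{g})=\mathfrak{g}\cdot Z(\mathfrak{g})=0$ for $\dim Z(\mathfrak{g})=1$.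
   Context: A commutative post-Lie algebra structure, or CPA-structure, on a Lie algebra $\mathfrak{g}$ over $K$ is a $K$-bilinear product $x\cdot y$ on the vector space $\mathfrak{g}$ such that for all $x,y,z\in\mathfrak{g}$: (1) $x\cdot y=y\cdot x$; (2) $[x,y]\cdot z=x\cdot(y\cdot z)-y\cdot(x\cdot z)$; (3) $x\cdot[y,z]=[x\cdot y,z]+[y,x\cdot z]$. By (3) each $L(x)$ is a derivation of $\mathfrak{g}$; $\mathrm{Der}(\mathfrak{g})$ is the Lie algebra of derivations of $\mathfrak{g}$. The lower central series is $\mathfrak{g}^1=\mathfrak{g}$, $\mathfrak{g}^{i+1}=[\mathfrak{g},\mathfrak{g}^i]$ for $i\ge1$. A characteristic ideal is an ideal invariant under all derivations of $\mathfrak{g}$. For a subspace $\mathfrak{a}\subseteq\mathfrak{g}$, $L(\mathfrak{a})^r(\mathfrak{g})$ denotes the span of all elements $L(a_1)L(a_2)\cdots L(a_r)(x)$ with $a_1,\dots,a_r\in\mathfrak{a}$ and $x\in\mathfrak{g}$. $Z(\mathfrak{g})$ is the center of $\mathfrak{g}$.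
   Formalization: The formal statement assumes t ≥ 2; for t = 1 the claim is false: take g = K abelian with x·y = xy and a = g = g^1, so r = 1 but L(g)(g) = K ≠ 0. *)

theory Defs
  imports Complex_Main
begin

text \<open>The underlying vector space of the Lie algebra is the whole type.\<close>

locale lie_algebra = vector_space scale
  for scale :: "'k::field \<Rightarrow> 'g::ab_group_add \<Rightarrow> 'g"
  and bracket :: "'g \<Rightarrow> 'g \<Rightarrow> 'g" +
  assumes bracket_linear_right: "Vector_Spaces.linear scale scale (bracket x)"
    and bracket_linear_left: "Vector_Spaces.linear scale scale (\<lambda>x. bracket x y)"
    and bracket_self: "bracket x x = 0"
    and jacobi: "bracket x (bracket y z) + bracket y (bracket z x) + bracket z (bracket x y) = 0"
begin

definition derivation :: "('g \<Rightarrow> 'g) \<Rightarrow> bool" where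
  "derivation D \<longleftrightarrow> Vector_Spaces.linear scale scale D \<and>
     (\<forall>x y. D (bracket x y) = bracket (D x) y + bracket x (D y))"

text \<open>The numbering starts at 1; the value at 0 is a dummy.\<close>

fun lower_central :: "nat \<Rightarrow> 'g set" where
  "lower_central 0 = UNIV"
| "lower_central (Suc 0) = UNIV"
| "lower_central (Suc (Suc n)) = span {bracket x y | x y. y \<in> lower_central (Suc n)}"

definition nilpotent :: bool where
  "nilpotent \<longleftrightarrow> (\<exists>n\<ge>1. lower_central n = {0})"

definition center :: "'g set" where
  "center = {z. \<forall>x. bracket z x = 0}"

definition lie_ideal :: "'g set \<Rightarrow> bool" where
  "lie_ideal I \<longleftrightarrow> subspace I \<and> (\<forall>x. \<forall>a\<in>I. bracket x a \<in> I)"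

definition characteristic_ideal :: "'g set \<Rightarrow> bool" where
  "characteristic_ideal I \<longleftrightarrow> lie_ideal I \<and> (\<forall>D. derivation D \<longrightarrow> D ` I \<subseteq> I)"

definition stem :: bool where
  "stem \<longleftrightarrow> center \<subseteq> lower_central 2"

end

locale cpa_structure = lie_algebra scale bracket
  for scale :: "'k::field \<Rightarrow> 'g::ab_group_add \<Rightarrow> 'g"
  and bracket :: "'g \<Rightarrow> 'g \<Rightarrow> 'g"
  and prod :: "'g \<Rightarrow> 'g \<Rightarrow> 'g" +
  assumes prod_linear_right: "Vector_Spaces.linear scale scale (prod x)"
    and prod_linear_left: "Vector_Spaces.linear scale scale (\<lambda>x. prod x y)"
    and prod_commute: "prod x y = prod y x"
    and bracket_prod: "prod (bracket x y) z = prod x (prod y z) - prod y (prod x z)"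
    and prod_bracket: "prod x (bracket y z) = bracket (prod x y) z + bracket y (prod x z)"
begin

definition L :: "'g \<Rightarrow> 'g \<Rightarrow> 'g" where
  "L x = (\<lambda>y. prod x y)"

lemma derivation_L: "derivation (L x)"
  by (simp add: derivation_def L_def prod_linear_right prod_bracket)

text \<open>For \<open>as = [a\<^sub>1, \<dots>, a\<^sub>r]\<close>, the generator \<open>foldr L as x\<close> is
  \<open>L a\<^sub>1 (L a\<^sub>2 (\<dots> (L a\<^sub>r x)))\<close>.\<close>

definition L_pow :: "'g set \<Rightarrow> nat \<Rightarrow> 'g set \<Rightarrow> 'g set" where
  "L_pow A r V = span {foldr L as x | as x. length as = r \<and> set as \<subseteq> A \<and> x \<in> V}"

definition prod_span :: "'g set \<Rightarrow> 'g set \<Rightarrow> 'g set" where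
  "prod_span A B = span {prod a b | a b. a \<in> A \<and> b \<in> B}"

end

end

theory Submission
  imports Defs
begin

text \<open>Each \<open>L x\<close> is nilpotent on \<open>[g, g]\<close>, by a Fitting argument. By Engel's argument, the chain
  \<open>a\<^sub>0 = a\<close>, \<open>a\<^sub>i\<^sub>+\<^sub>1 = g \<cdot> a\<^sub>i\<close> of stable subspaces of \<open>a \<subseteq> [g, g]\<close> therefore drops in
  dimension until it reaches 0, so \<open>a\<^sub>i = 0\<close> for \<open>i \<ge> dim a\<close>. Since \<open>L\<close> turns brackets into
  commutators, an element of \<open>g\<^sup>t\<close> maps \<open>a\<^sub>i\<close> into \<open>a\<^sub>i\<^sub>+\<^sub>t\<close>. By commutativity the innermost factor
  maps \<open>g\<close> into \<open>a\<^sub>1\<close>, and the remaining \<open>r - 1\<close> factors reach index \<open>1 + t (r - 1) \<ge> dim a\<close>.\<close>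

section \<open>Iterates of a linear map and Fitting's lemma\<close>

lemma (in vector_space) linear_funpow:
  assumes "Vector_Spaces.linear scale scale f"
  shows "Vector_Spaces.linear scale scale (f ^^ n)"
proof (induction n)
  case 0
  show ?case by (simp add: Vector_Spaces.linear_iff vector_space_axioms)
next
  case (Suc n)
  then show ?case using assms by (simp add: Vector_Spaces.linear_iff)
qed

text \<open>The kernels of the powers of \<open>f\<close> increase and the images decrease, so a
  kernel of greatest and an image of least dimension stop both chains. A single \<open>M\<close>
  that serves both is what later splits the space into kernel and image of
  \<open>f ^^ M\<close>.\<close>

lemma (in finite_dimensional_vector_space) fitting:
  assumes f: "Vector_Spaces.linear scale scale f"
  obtains M where "\<And>n v. (f ^^ n) v = 0 \<Longrightarrow> (f ^^ M) v = 0"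
    and "\<And>n. range (f ^^ M) \<subseteq> range (f ^^ (M + n))"
proof -
  define K where "K n = {v. (f ^^ n) v = 0}" for n
  define R where "R n = range (f ^^ n)" for n
  note lin = linear_funpow[OF f]
  have hom: "module_hom scale scale (f ^^ n)" for n
    using lin by (simp add: module_hom_iff_linear)
  have subK: "subspace (K n)" for n
    unfolding K_def using module_hom.subspace_kernel[OF hom] .
  have subR: "subspace (R n)" for n
    unfolding R_def using module_hom.subspace_image[OF hom subspace_UNIV] .
  have Kmono: "K n \<subseteq> K (m + n)" for m n
    using module_hom.zero[OF hom[of m]] by (auto simp: K_def funpow_add)
  have Rmono: "R (m + n) \<subseteq> R m" for m n
    by (auto simp: R_def funpow_add)
  obtain p where p: "\<And>n. dim (K n) \<le> dim (K p)"
    using ex_has_greatest_nat[of "\<lambda>_. True" 0 "\<lambda>n. dim (K n)" "Suc dimension"] dim_subset_UNIV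
    by (auto simp: less_Suc_eq_le)
  obtain q where q: "\<And>n. dim (R q) \<le> dim (R n)"
    using ex_has_least_nat[of "\<lambda>_. True" 0 "\<lambda>n. dim (R n)"] by auto
  have Keq: "K p = K (m + p)" for m
    using subspace_dim_equal[OF subK subK Kmono p] .
  have Req: "R (q + n) = R q" for n
    using subspace_dim_equal[OF subR subR Rmono q] .
  \<comment> \<open>The exponent \<open>q + p\<close> lies beyond both \<open>p\<close> and
    \<open>q\<close>, so both chains are constant from there on.\<close>
  show thesis
  proof (rule that[of "q + p"])
    fix n v assume "(f ^^ n) v = 0"
    then have "v \<in> K n" by (simp add: K_def)
    then have "v \<in> K (p + n)" using Kmono by blast
    then have "v \<in> K p" using Keq[of n] by (simp add: add.commute)
    then have "v \<in> K (q + p)" using Kmono by blast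
    then show "(f ^^ (q + p)) v = 0" by (simp add: K_def)
  next
    fix n
    have "R (q + p) = R (q + (p + n))" using Req by simp
    then show "range (f ^^ (q + p)) \<subseteq> range (f ^^ (q + p + n))"
      by (simp add: R_def add.assoc)
  qed
qed

section \<open>Brackets, lower central series and center\<close>

context lie_algebra
begin

lemma bracket_add_right: "bracket x (u + v) = bracket x u + bracket x v"
  and bracket_scale_right: "bracket x (scale c u) = scale c (bracket x u)"
  using bracket_linear_right by (simp_all add: Vector_Spaces.linear_iff)

lemma bracket_add_left: "bracket (u + v) x = bracket u x + bracket v x"
  and bracket_scale_left: "bracket (scale c u) x = scale c (bracket u x)"
  using bracket_linear_left by (simp_all add: Vector_Spaces.linear_iff)

lemma bracket_zero_right [simp]: "bracket x 0 = 0"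
  using bracket_scale_right[of x 0 0] by simp

lemma bracket_zero_left [simp]: "bracket 0 x = 0"
  using bracket_scale_left[of 0 0 x] by simp

lemma bracket_diff_right: "bracket x (u - v) = bracket x u - bracket x v"
  using bracket_add_right[of x "u - v" v] by simp

lemma bracket_diff_left: "bracket (u - v) x = bracket u x - bracket v x"
  using bracket_add_left[of "u - v" v x] by simp

lemma bracket_anticommute: "bracket x y = - bracket y x"
proof -
  have "bracket (x + y) (x + y) = bracket x x + bracket x y + (bracket y x + bracket y y)"
    by (simp add: bracket_add_left bracket_add_right)
  then have "bracket x y + bracket y x = 0"
    by (simp add: bracket_self)
  then show ?thesis by (simp add: eq_neg_iff_add_eq_0)
qed

lemma bracket_lower_central:
  assumes "1 \<le> j" "y \<in> lower_central j"
  shows "bracket x y \<in> lower_central (Suc j)"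
  using assms by (cases j) (auto intro!: span_base)

lemma lower_central_subset_2:
  assumes "2 \<le> t"
  shows "lower_central t \<subseteq> lower_central 2"
proof -
  obtain n where t: "t = Suc (Suc n)"
    using assms by (metis add_2_eq_Suc le_Suc_ex)
  show ?thesis
    unfolding t numeral_2_eq_2 lower_central.simps by (rule span_mono) auto
qed

text \<open>Each bracket moves one step down the lower central series, which gives one exponent for
  all \<open>x\<close> and \<open>y\<close>; it is \<open>n - 1\<close> because the series is
  numbered from 1.\<close>

lemma nilpotent_imp_ad_nilpotent:
  assumes nilpotent
  obtains k where "\<And>x y. (bracket x ^^ k) y = 0"
proof -
  obtain n where n: "n \<ge> 1" "lower_central n = {0}"
    using assms by (auto simp: nilpotent_def)
  have "(bracket x ^^ k) y \<in> lower_central (Suc k)" for x y k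
    by (induction k) (auto intro!: bracket_lower_central simp del: lower_central.simps(3))
  from this[of "n - 1"] n show thesis by (intro that[of "n - 1"]) auto
qed

text \<open>Applying a derivation \<open>D\<close> to \<open>bracket z x = 0\<close> shows that
  \<open>bracket (D z) x\<close> is the negative of \<open>bracket z (D x)\<close>, which vanishes
  for central \<open>z\<close>.\<close>

lemma characteristic_ideal_center: "characteristic_ideal center"
proof -
  have "subspace center"
    by (rule subspaceI) (auto simp: center_def bracket_add_left bracket_scale_left)
  moreover have "bracket x a \<in> center" if "a \<in> center" for x a
    using that bracket_anticommute[of x a] by (simp add: center_def)
  moreover have "D z \<in> center" if "derivation D" "z \<in> center" for D z
  proof -
    have "bracket (D z) x = 0" for x
    proof -
      have "D (bracket z x) = bracket (D z) x + bracket z (D x)"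
        using that by (simp add: derivation_def)
      moreover have "D 0 = 0"
        using that by (auto simp: derivation_def linear_iff_module_hom intro: module_hom.zero)
      ultimately show ?thesis using that by (simp add: center_def)
    qed
    then show ?thesis by (simp add: center_def)
  qed
  ultimately show ?thesis by (auto simp: characteristic_ideal_def lie_ideal_def)
qed

end

section \<open>Generalized eigenspaces and image powers of left multiplications\<close>

context cpa_structure
begin

lemma prod_add_right: "prod x (u + v) = prod x u + prod x v"
  and prod_scale_right: "prod x (scale c u) = scale c (prod x u)"
  using prod_linear_right by (simp_all add: Vector_Spaces.linear_iff)

lemma prod_add_left: "prod (u + v) x = prod u x + prod v x"
  and prod_scale_left: "prod (scale c u) x = scale c (prod u x)"
  using prod_linear_left by (simp_all add: Vector_Spaces.linear_iff)

lemma prod_zero_right [simp]: "prod x 0 = 0"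
  using prod_scale_right[of x 0 0] by simp

lemma prod_zero_left [simp]: "prod 0 x = 0"
  using prod_scale_left[of 0 0 x] by simp

lemma prod_diff_right: "prod x (u - v) = prod x u - prod x v"
  using prod_add_right[of x "u - v" v] by simp

lemma prod_prod_commute: "prod x (prod y z) = prod y (prod x z) + prod (bracket x y) z"
  by (simp add: bracket_prod)

text \<open>The kernels of the powers of \<open>shift x c\<close> make up the generalized eigenspace
  of \<open>L x\<close> for \<open>c\<close>, so eigenspaces can be handled by induction on
  exponents.\<close>

definition shift :: "'g \<Rightarrow> 'k \<Rightarrow> 'g \<Rightarrow> 'g" where
  "shift x c v = prod x v - scale c v"

lemma shift_0: "shift x 0 = prod x"
  by (simp add: shift_def fun_eq_iff)

lemma linear_shift: "Vector_Spaces.linear scale scale (shift x c)"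
  unfolding Vector_Spaces.linear_iff
  by (auto simp: shift_def prod_add_right prod_scale_right scale_right_diff_distrib
      scale_right_distrib vector_space_axioms mult.commute)

lemma shift_add: "shift x c (u + v) = shift x c u + shift x c v"
  using linear_shift by (simp add: Vector_Spaces.linear_iff)

lemma funpow_shift_add: "(shift x c ^^ n) (u + v) = (shift x c ^^ n) u + (shift x c ^^ n) v"
  by (induction n) (simp_all add: shift_add)

lemma funpow_shift_zero [simp]: "(shift x c ^^ n) 0 = 0"
  by (induction n) (simp_all add: shift_def)

lemma funpow_shift_scale: "(shift x c ^^ n) (scale d v) = scale d ((shift x c ^^ n) v)"
  using linear_shift by (induction n) (simp_all add: Vector_Spaces.linear_iff)

lemma shift_prod: "shift x c (prod y v) = prod y (shift x c v) + prod (bracket x y) v"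
  by (simp add: shift_def prod_diff_right prod_scale_right prod_prod_commute[of x y])

text \<open>A twisted Leibniz rule: since \<open>L x\<close> is a derivation, eigenvalues add under
  the bracket.\<close>

lemma shift_bracket:
  "shift x (a + b) (bracket u v) = bracket (shift x a u) v + bracket u (shift x b v)"
  by (simp add: shift_def prod_bracket bracket_diff_left bracket_diff_right bracket_scale_left
      bracket_scale_right scale_left_distrib)

text \<open>Moving one \<open>shift x c\<close> past \<open>L y\<close> either reaches
  \<open>v\<close> and lowers \<open>n\<close>, or replaces \<open>y\<close> by
  \<open>bracket x y\<close> and lowers \<open>k\<close>. Hence the induction on
  \<open>n + k\<close>.\<close>

lemma generalized_eigenspace_invariant:
  assumes "(bracket x ^^ k) y = 0" "(shift x c ^^ n) v = 0"
  shows "(shift x c ^^ (n + k)) (prod y v) = 0"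
  using assms
proof (induction "n + k" arbitrary: n k y v)
  case 0
  then show ?case by simp
next
  case (Suc s)
  show ?case
  proof (cases "n = 0 \<or> k = 0")
    case True
    then show ?thesis using Suc.prems by auto
  next
    case False
    then obtain n' k' where nk: "n = Suc n'" "k = Suc k'"
      by (metis not0_implies_Suc)
    have "(shift x c ^^ (n' + k)) (prod y (shift x c v)) = 0"
      by (rule Suc.hyps(1)) (use Suc nk in \<open>auto simp: funpow_swap1\<close>)
    moreover have "(shift x c ^^ (n + k')) (prod (bracket x y) v) = 0"
      by (rule Suc.hyps(1)) (use Suc nk in \<open>auto simp: funpow_swap1\<close>)
    moreover have "(shift x c ^^ (n + k)) (prod y v) =
        (shift x c ^^ (n' + k)) (shift x c (prod y v))"
      by (simp add: nk funpow_swap1)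
    ultimately show ?thesis
      by (simp add: shift_prod funpow_shift_add nk shift_add)
  qed
qed

text \<open>By the twisted Leibniz rule, each application of the shift to the bracket lowers
  \<open>m\<close> in one summand and \<open>n\<close> in the other.\<close>

lemma generalized_eigenspace_bracket:
  assumes "(shift x a ^^ m) u = 0" "(shift x b ^^ n) v = 0"
  shows "(shift x (a + b) ^^ (m + n)) (bracket u v) = 0"
  using assms
proof (induction "m + n" arbitrary: m n u v)
  case 0
  then show ?case by simp
next
  case (Suc s)
  show ?case
  proof (cases "m = 0 \<or> n = 0")
    case True
    then show ?thesis using Suc.prems by auto
  next
    case False
    then obtain m' n' where mn: "m = Suc m'" "n = Suc n'"
      by (metis not0_implies_Suc)
    have "(shift x (a + b) ^^ (m' + n)) (bracket (shift x a u) v) = 0"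
      by (rule Suc.hyps(1)) (use Suc mn in \<open>auto simp: funpow_swap1\<close>)
    moreover have "(shift x (a + b) ^^ (m + n')) (bracket u (shift x b v)) = 0"
      by (rule Suc.hyps(1)) (use Suc mn in \<open>auto simp: funpow_swap1\<close>)
    moreover have "(shift x (a + b) ^^ (m + n)) (bracket u v) =
        (shift x (a + b) ^^ (m' + n)) (shift x (a + b) (bracket u v))"
      by (simp add: mn funpow_swap1)
    ultimately show ?thesis
      by (simp add: shift_bracket funpow_shift_add mn shift_add)
  qed
qed

text \<open>The two shifts commute, so the induction hypothesis applies to
  \<open>shift x a v\<close> and \<open>shift x b v\<close>. Both vanish, and their difference is a
  nonzero multiple of \<open>v\<close>.\<close>

lemma generalized_eigenspaces_disjoint:
  assumes "a \<noteq> b" "(shift x a ^^ m) v = 0" "(shift x b ^^ n) v = 0"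
  shows "v = 0"
  using assms(2,3)
proof (induction "m + n" arbitrary: m n v)
  case 0
  then show ?case by simp
next
  case (Suc s)
  show ?case
  proof (cases "m = 0 \<or> n = 0")
    case True
    then show ?thesis using Suc.prems by auto
  next
    case False
    then obtain m' n' where mn: "m = Suc m'" "n = Suc n'"
      by (metis not0_implies_Suc)
    have comm: "shift x c (shift x d u) = shift x d (shift x c u)" for c d u
      by (simp add: shift_def prod_diff_right prod_scale_right scale_right_diff_distrib mult.commute)
    have comm': "(shift x c ^^ j) (shift x d u) = shift x d ((shift x c ^^ j) u)" for c d u j
      by (induction j) (simp_all add: comm)
    have swap: "(shift x c ^^ j) (shift x d u) = 0" if "(shift x c ^^ j) u = 0" for c d u j
      using that comm'[where c=c and j=j and d=d and u=u] by (simp add: shift_def[of x d 0])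
    have "(shift x a ^^ m') (shift x a v) = 0" "(shift x b ^^ n') (shift x b v) = 0"
      using Suc.prems mn by (simp_all add: funpow_swap1)
    then have "shift x a v = 0" "shift x b v = 0"
      using Suc.hyps(1)[of m' n "shift x a v"] Suc.hyps(1)[of m n' "shift x b v"]
        swap[OF Suc.prems(1), of b] swap[OF Suc.prems(2), of a] Suc.hyps(2) mn by auto
    then have "scale (a - b) v = 0"
      by (simp add: shift_def scale_left_diff_distrib)
    then show ?thesis using \<open>a \<noteq> b\<close> by simp
  qed
qed

text \<open>The counterpart for images: pulling one \<open>L x\<close> out to the left of
  \<open>L y\<close> either supplies one factor of the required power or leaves
  \<open>bracket x y\<close> in place of \<open>y\<close>.\<close>

lemma range_funpow_invariant:
  assumes "(bracket x ^^ k) y = 0"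
  shows "prod y ((prod x ^^ (n + k)) v) \<in> range (prod x ^^ n)"
  using assms
proof (induction "n + k" arbitrary: n k y)
  case 0
  then show ?case by simp
next
  case (Suc s)
  have zero: "0 \<in> range (prod x ^^ n)" for n
    using funpow_shift_zero[of n x 0] by (metis rangeI shift_0)
  show ?case
  proof (cases "n = 0 \<or> k = 0")
    case True
    then show ?thesis using Suc.prems zero by auto
  next
    case False
    then obtain n' k' where nk: "n = Suc n'" "k = Suc k'"
      by (metis not0_implies_Suc)
    have "prod y ((prod x ^^ (n' + k)) v) \<in> range (prod x ^^ n')"
      by (rule Suc.hyps(1)) (use Suc nk in auto)
    then obtain p where p: "prod y ((prod x ^^ (n' + k)) v) = (prod x ^^ n') p" by auto
    have "prod (bracket x y) ((prod x ^^ (n + k')) v) \<in> range (prod x ^^ n)"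
      by (rule Suc.hyps(1)) (use Suc nk in \<open>auto simp: funpow_swap1\<close>)
    then obtain q where q: "prod (bracket x y) ((prod x ^^ (n + k')) v) = (prod x ^^ n) q" by auto
    have "prod y ((prod x ^^ (n + k)) v) = prod y (prod x ((prod x ^^ (n' + k)) v))"
      by (simp add: nk)
    also have "\<dots> = prod x (prod y ((prod x ^^ (n' + k)) v)) - prod (bracket x y) ((prod x ^^ (n' + k)) v)"
      by (simp add: bracket_prod)
    also have "n' + k = n + k'" by (simp add: nk)
    also have "prod x (prod y ((prod x ^^ (n + k')) v)) - prod (bracket x y) ((prod x ^^ (n + k')) v)
        = (prod x ^^ n) p + (prod x ^^ n) (- q)"
      using p q funpow_shift_scale[where c=0 and d="-1" and v=q and n=n and x=x]
      by (simp add: nk shift_0)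
    also have "\<dots> = (prod x ^^ n) (p + - q)"
      using funpow_shift_add[of n x 0 p "- q"] by (simp add: shift_0)
    finally show ?thesis by (metis rangeI)
  qed
qed

section \<open>Stable subspaces and the descending chain\<close>

definition stable :: "'g set \<Rightarrow> bool" where
  "stable U \<longleftrightarrow> subspace U \<and> (\<forall>x. \<forall>u\<in>U. prod x u \<in> U)"

text \<open>As the span lies in \<open>U\<close>, any product with one of its elements is again one
  of its generators. Stability is therefore inherited along the whole chain.\<close>

lemma stable_prod_span:
  assumes "stable U"
  shows "stable (prod_span UNIV U)" "prod_span UNIV U \<subseteq> U"
proof -
  show sub: "prod_span UNIV U \<subseteq> U"
    unfolding prod_span_def by (rule span_minimal) (use assms in \<open>auto simp: stable_def\<close>)
  then show "stable (prod_span UNIV U)"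
    unfolding stable_def by (auto simp: prod_span_def intro!: span_base)
qed

definition descend :: "'g set \<Rightarrow> nat \<Rightarrow> 'g set" where
  "descend a i = (prod_span UNIV ^^ i) a"

lemma prod_mem_descend:
  assumes "u \<in> descend a i"
  shows "prod x u \<in> descend a (Suc i)"
  using assms by (auto simp: descend_def prod_span_def intro!: span_base)

lemma stable_descend:
  assumes "stable a"
  shows "stable (descend a i)" "descend a i \<subseteq> a"
  using assms stable_prod_span by (induction i) (auto simp: descend_def)

text \<open>For \<open>y\<close> in \<open>lower_central t\<close>, \<open>L (bracket x y)\<close>
  is the commutator of \<open>L x\<close>, which gains one index, and \<open>L y\<close>, which
  gains \<open>t\<close>; so it gains \<open>t + 1\<close>.\<close>

lemma prod_lower_central_descend:
  assumes "stable a" "1 \<le> t" "c \<in> lower_central t" "u \<in> descend a i"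
  shows "prod c u \<in> descend a (i + t)"
  using assms(2-4)
proof (induction t arbitrary: c u i rule: dec_induct)
  case base
  then show ?case using prod_mem_descend by simp
next
  case (step t)
  have sub: "subspace (descend a j)" for j
    using stable_descend[OF assms(1)] by (auto simp: stable_def)
  \<comment> \<open>Being a subspace, \<open>S\<close> contains a span as soon as it contains the
    generating brackets.\<close>
  define S where "S = {c. \<forall>i. \<forall>u\<in>descend a i. prod c u \<in> descend a (i + Suc t)}"
  have "subspace S"
    by (rule subspaceI)
      (auto simp: S_def prod_add_left prod_scale_left
        intro: subspace_0[OF sub] subspace_add[OF sub] subspace_scale[OF sub])
  moreover have "bracket x y \<in> S" if y: "y \<in> lower_central t" for x y
  proof -
    have "prod (bracket x y) u \<in> descend a (i + Suc t)" if u: "u \<in> descend a i" for i u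
    proof -
      have "prod x (prod y u) \<in> descend a (i + Suc t)"
        using prod_mem_descend[OF step.IH[OF y u]] by simp
      moreover have "prod y (prod x u) \<in> descend a (i + Suc t)"
        using step.IH[OF y prod_mem_descend[OF u]] by simp
      ultimately show ?thesis
        using subspace_diff[OF sub] by (simp add: bracket_prod)
    qed
    then show ?thesis by (simp add: S_def)
  qed
  moreover have "lower_central (Suc t) = span {bracket x y | x y. y \<in> lower_central t}"
    using step.hyps by (cases t) auto
  ultimately have "lower_central (Suc t) \<subseteq> S"
    using span_minimal[of "{bracket x y | x y. y \<in> lower_central t}" S] by auto
  then show ?case using step.prems by (auto simp: S_def)
qed

lemma foldr_L_mem_descend:
  assumes a: "stable a" "a \<subseteq> lower_central t" "1 \<le> t"
    and "as \<noteq> []" "set as \<subseteq> a"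
  shows "foldr L as x \<in> descend a (Suc (t * (length as - 1)))"
  using assms(4,5)
proof (induction as)
  case (Cons c as)
  show ?case
  proof (cases "as = []")
    case True
    \<comment> \<open>The innermost factor acts on an arbitrary \<open>x\<close>. By commutativity
      \<open>x\<close> acts on \<open>c\<close> in \<open>descend a 0\<close> instead, so this
      factor contributes only 1 to the index rather than \<open>t\<close>.\<close>
    have "prod x c \<in> descend a (Suc 0)"
      using prod_mem_descend[of c a 0] Cons.prems by (simp add: descend_def)
    then show ?thesis using True by (simp add: L_def prod_commute)
  next
    case False
    have "prod c (foldr L as x) \<in> descend a (Suc (t * (length as - 1)) + t)"
      by (rule prod_lower_central_descend[OF a(1,3)]) (use a(2) Cons False in auto)
    moreover have "Suc (t * (length as - 1)) + t = Suc (t * length as)"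
      using False by (cases as) auto
    ultimately show ?thesis by (simp add: L_def[of c])
  qed
qed simp

end

section \<open>Nilpotent Lie algebras of finite dimension: Fitting and Engel arguments\<close>

locale nilpotent_cpa = cpa_structure scale bracket prod + finite_dimensional_vector_space scale Basis
  for scale :: "'k::field_char_0 \<Rightarrow> 'g::ab_group_add \<Rightarrow> 'g"
  and bracket prod Basis +
  assumes nilpotent: "nilpotent"
begin

text \<open>Let \<open>G0 + G1\<close> be the Fitting decomposition of \<open>L x\<close>. Both parts are stable, so
  \<open>G0 \<cdot> G1 = 0\<close>, and only the component \<open>w\<close> of \<open>x\<close> in \<open>G1\<close> acts on \<open>G1\<close>, bijectively.
  If \<open>w \<cdot> e = w\<close>, then the generalized eigenspace of \<open>L e\<close> for 1 is stable and contains \<open>w\<close>,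
  hence contains \<open>G1\<close>. On \<open>[G1, G1]\<close> the derivation \<open>L e\<close> then has eigenvalue 2, while its
  only eigenvalues are 0 and 1.\<close>

lemma prod_nilpotent_on_commutator:
  "\<exists>m. \<forall>z\<in>lower_central 2. (prod x ^^ m) z = 0"
proof -
  obtain k where k: "\<And>x y. (bracket x ^^ k) y = 0"
    using nilpotent_imp_ad_nilpotent[OF nilpotent] by blast
  obtain M where M0: "\<And>n v. (prod x ^^ n) v = 0 \<Longrightarrow> (prod x ^^ M) v = 0"
    and M1: "\<And>n. range (prod x ^^ M) \<subseteq> range (prod x ^^ (M + n))"
    using fitting[OF prod_linear_right] by blast
  define G0 where "G0 = {v. (prod x ^^ M) v = 0}"
  define G1 where "G1 = range (prod x ^^ M)"
  have hom: "module_hom scale scale (prod x ^^ M)"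
    using linear_funpow[OF prod_linear_right] by (simp add: module_hom_iff_linear)
  have sub0: "subspace G0"
    unfolding G0_def using module_hom.subspace_kernel[OF hom] .
  have inv0: "prod y v \<in> G0" if "v \<in> G0" for y v
    using M0 generalized_eigenspace_invariant[OF k[of x y], where c=0 and n=M and v=v] that
    by (auto simp: G0_def shift_0)
  have inv1: "prod y v \<in> G1" if "v \<in> G1" for y v
  proof -
    obtain v' where "v = (prod x ^^ (M + k)) v'"
      using \<open>v \<in> G1\<close> M1[of k] by (auto simp: G1_def)
    then show ?thesis using range_funpow_invariant[OF k] by (simp add: G1_def)
  qed
  have dis: "v = 0" if "v \<in> G0" "v \<in> G1" for v
  proof -
    obtain u where u: "v = (prod x ^^ M) u" using \<open>v \<in> G1\<close> by (auto simp: G1_def)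
    have "(prod x ^^ (M + M)) u = 0" using \<open>v \<in> G0\<close> u by (simp add: G0_def funpow_add)
    then show ?thesis using M0 u by blast
  qed
  have dec: "\<exists>p q. p \<in> G0 \<and> q \<in> G1 \<and> v = p + q" for v
  proof -
    obtain u where u: "(prod x ^^ M) v = (prod x ^^ (M + M)) u"
      using M1[of M] by blast
    have "(prod x ^^ M) (v - (prod x ^^ M) u) = 0"
      using u by (simp add: module_hom.diff[OF hom] funpow_add)
    then show ?thesis
      by (intro exI[of _ "v - (prod x ^^ M) u"] exI[of _ "(prod x ^^ M) u"])
        (auto simp: G0_def G1_def)
  qed
  \<comment> \<open>By commutativity the product lies in both components, which meet only in
    0.\<close>
  have ann: "prod u v = 0" if "u \<in> G0" "v \<in> G1" for u v
    using that inv0[of u v] inv1[of v u] dis prod_commute[of u v] by auto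
  have ann': "prod v u = 0" if "u \<in> G0" "v \<in> G1" for u v
    using ann[OF that] by (simp add: prod_commute)
  obtain x0 w where w: "x0 \<in> G0" "w \<in> G1" "x = x0 + w"
    using dec by blast
  have xw: "prod x v = prod w v" if "v \<in> G1" for v
    using ann[OF w(1) that] by (simp add: w(3) prod_add_left)
  have onto: "\<exists>v'\<in>G1. v = prod w v'" if v: "v \<in> G1" for v
  proof -
    obtain u where "v = (prod x ^^ (M + 1)) u"
      using v M1[of 1] unfolding G1_def by blast
    then have "v = prod x ((prod x ^^ M) u)" by simp
    then show ?thesis using xw by (auto simp: G1_def)
  qed
  \<comment> \<open>On \<open>G1\<close> the map \<open>L w\<close> agrees with \<open>L x\<close>,
    which is injective there.\<close>
  have ker_w: "z \<in> G0" if z: "prod w z = 0" for z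
  proof -
    obtain p q where pq: "p \<in> G0" "q \<in> G1" "z = p + q" using dec by blast
    then have "prod w q = 0" using z ann' w(2) by (simp add: prod_add_right)
    then have "(prod x ^^ 1) q = 0" using xw[OF pq(2)] by simp
    then have "q \<in> G0" using M0 unfolding G0_def by blast
    then have "q = 0" using dis pq(2) by blast
    then show ?thesis using pq by simp
  qed
  obtain e where e: "e \<in> G1" "prod w e = w"
    using onto[OF w(2)] by metis
  \<comment> \<open>Every element of \<open>G1\<close> has the form \<open>prod w v'\<close>, so it
    arises from the eigenvector \<open>w\<close> by one left multiplication.\<close>
  have unipotent: "\<exists>n. (shift e 1 ^^ n) v = 0" if "v \<in> G1" for v
  proof -
    have "(shift e 1 ^^ 1) w = 0"
      using e(2) by (simp add: shift_def prod_commute)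
    then have "(shift e 1 ^^ (1 + k)) (prod y w) = 0" for y
      by (rule generalized_eigenspace_invariant[OF k])
    then show ?thesis using onto[OF that] prod_commute by metis
  qed
  \<comment> \<open>Membership in \<open>G0\<close> is tested by \<open>L w\<close>. It kills
    \<open>bracket u p\<close> by the derivation rule, and \<open>bracket u q\<close> by
    commutativity and the commutator rule.\<close>
  have br0: "bracket u v \<in> G0" if u: "u \<in> G0" for u v
  proof -
    obtain p q where pq: "p \<in> G0" "q \<in> G1" "v = p + q" using dec by blast
    have "prod w (bracket u p) = 0"
      using ann' u pq(1) w(2) by (simp add: prod_bracket)
    moreover have "prod w (bracket u q) = 0"
    proof -
      have "prod (bracket u q) w = 0"
        using ann[OF u inv1[OF w(2)]] ann[OF u w(2)] by (simp add: bracket_prod)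
      then show ?thesis by (simp add: prod_commute)
    qed
    ultimately show ?thesis
      by (intro ker_w) (simp add: pq(3) bracket_add_right prod_add_right)
  qed
  have br1: "bracket u v \<in> G0" if uv: "u \<in> G1" "v \<in> G1" for u v
  proof -
    obtain m n where "(shift e 1 ^^ m) u = 0" "(shift e 1 ^^ n) v = 0"
      using unipotent uv by metis
    then have two: "(shift e (1 + 1) ^^ (m + n)) (bracket u v) = 0"
      by (rule generalized_eigenspace_bracket)
    obtain p q where pq: "p \<in> G0" "q \<in> G1" "bracket u v = p + q" using dec by blast
    \<comment> \<open>Applying \<open>L e\<close> removes the \<open>G0\<close> component of the
      bracket. The result \<open>y\<close> lies in \<open>G1\<close>, hence in the eigenspace for 1,
      and also in the one for 2.\<close>
    define y where "y = prod e (bracket u v)"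
    have y: "y \<in> G1"
      using inv1 ann' pq e(1) by (simp add: y_def prod_add_right)
    obtain l where l: "(shift e 1 ^^ l) y = 0" using unipotent[OF y] by blast
    have "(shift e (1 + 1) ^^ (m + n + k)) y = 0"
      unfolding y_def by (rule generalized_eigenspace_invariant[OF k two])
    then have "y = 0"
      using generalized_eigenspaces_disjoint[where a="1 + 1" and b=1 and v=y] l by simp
    \<comment> \<open>The bracket now belongs to the eigenspaces for 0 and 2, which are different
      scalars in characteristic zero.\<close>
    then have "(shift e 0 ^^ 1) (bracket u v) = 0"
      by (simp add: y_def shift_0)
    then have "bracket u v = 0"
      by (intro generalized_eigenspaces_disjoint[OF _ _ two, where a=0 and m=1]) simp_all
    then show ?thesis using sub0 by (simp add: subspace_0)
  qed
  have br: "bracket u v \<in> G0" for u v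
  proof -
    obtain p q where pq: "p \<in> G0" "q \<in> G1" "u = p + q" using dec by blast
    obtain p' q' where pq': "p' \<in> G0" "q' \<in> G1" "v = p' + q'" using dec by blast
    have "bracket q p' \<in> G0"
      using br0[OF pq'(1), of q] bracket_anticommute[of q p'] subspace_neg[OF sub0] by simp
    then have "bracket q v \<in> G0"
      using br1[OF pq(2) pq'(2)] subspace_add[OF sub0] by (simp add: pq'(3) bracket_add_right)
    then show ?thesis
      using br0[OF pq(1)] subspace_add[OF sub0] by (simp add: pq(3) bracket_add_left)
  qed
  have "lower_central 2 \<subseteq> G0"
    unfolding numeral_2_eq_2 lower_central.simps by (rule span_minimal) (use br sub0 in auto)
  then show ?thesis by (auto simp: G0_def)
qed

text \<open>The argument of Engel's theorem, for a maximal proper stable subspace \<open>W\<close> of \<open>U\<close>: by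
  descending induction along the lower central series, each \<open>L x\<close> maps \<open>U\<close> into \<open>W\<close>.\<close>

lemma dim_prod_span_less:
  assumes U: "stable U" "U \<noteq> {0}" "U \<subseteq> lower_central 2"
  shows "dim (prod_span UNIV U) < dim U"
proof -
  have subU: "subspace U" and invU: "\<And>x u. u \<in> U \<Longrightarrow> prod x u \<in> U"
    using U(1) by (auto simp: stable_def)
  define P where "P W \<longleftrightarrow> stable W \<and> W \<subseteq> U \<and> W \<noteq> U" for W
  have "P {0}" using U(2) subU by (auto simp: P_def stable_def subspace_0)
  then obtain W where W: "P W" and max: "\<And>W'. P W' \<Longrightarrow> dim W' \<le> dim W"
    using ex_has_greatest_nat[of P "{0}" dim "Suc dimension"] dim_subset_UNIV
    by (auto simp: less_Suc_eq_le)
  have subW: "subspace W" and invW: "\<And>x u. u \<in> W \<Longrightarrow> prod x u \<in> W"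
    and WU: "W \<subseteq> U" "W \<noteq> U"
    using W by (auto simp: P_def stable_def)
  obtain n where n: "1 \<le> n" "lower_central n = {0}"
    using nilpotent by (auto simp: nilpotent_def)
  have "\<forall>x\<in>lower_central 1. \<forall>u\<in>U. prod x u \<in> W"
    using n(1)
  proof (induction rule: inc_induct)
    case base
    then show ?case using n(2) subW by (auto simp: subspace_0)
  next
    case (step j)
    show ?case
    proof
      fix x assume x: "x \<in> lower_central j"
      \<comment> \<open>\<open>V\<close> is stable because, modulo \<open>W\<close>, the map
        \<open>L x\<close> commutes with every \<open>L y\<close> on \<open>U\<close>: their
        commutator comes from one step further down the series. Maximality of \<open>W\<close> then
        leaves only \<open>V = W\<close> or \<open>V = U\<close>.\<close>
      define V where "V = {prod x u + v | u v. u \<in> U \<and> v \<in> W}"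
      have "V = {a + b | a b. a \<in> prod x ` U \<and> b \<in> W}"
        by (auto simp: V_def)
      moreover have "subspace (prod x ` U)"
        using module_hom.subspace_image[of scale scale "prod x" U] prod_linear_right subU
        by (simp add: module_hom_iff_linear)
      ultimately have subV: "subspace V"
        using subspace_sums subW by simp
      have WV: "W \<subseteq> V"
      proof
        fix v assume "v \<in> W"
        then have "prod x 0 + v \<in> V" using subspace_0[OF subU] unfolding V_def by blast
        then show "v \<in> V" by simp
      qed
      have VU: "V \<subseteq> U"
        using WU(1) invU subspace_add[OF subU] by (auto simp: V_def)
      have invV: "prod y z \<in> V" if z: "z \<in> V" for y z
      proof -
        obtain u v where uv: "u \<in> U" "v \<in> W" "z = prod x u + v" using z by (auto simp: V_def)
        have "bracket y x \<in> lower_central (Suc j)"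
          using bracket_lower_central x step.hyps by simp
        then have "prod (bracket y x) u + prod y v \<in> W"
          using step.IH uv invW subspace_add[OF subW] by blast
        moreover have "prod y z = prod x (prod y u) + (prod (bracket y x) u + prod y v)"
          by (simp add: uv(3) prod_add_right prod_prod_commute[of y x])
        ultimately show ?thesis using invU[OF uv(1)] by (auto simp: V_def)
      qed
      have "V \<noteq> U"
      proof
        assume VeqU: "V = U"
        \<comment> \<open>Iterating \<open>V = U\<close> writes \<open>U\<close> as its image under
          any power of \<open>L x\<close> plus \<open>W\<close>; nilpotency of \<open>L x\<close> on
          \<open>U\<close> would then give \<open>U \<subseteq> W\<close>.\<close>
        have pow: "\<forall>u\<in>U. \<exists>u'\<in>U. \<exists>v\<in>W. u = (prod x ^^ i) u' + v" for i
        proof (induction i)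
          case 0
          then show ?case using subspace_0[OF subW] by force
        next
          case (Suc i)
          show ?case
          proof
            fix u assume "u \<in> U"
            then obtain u1 v1 where 1: "u1 \<in> U" "v1 \<in> W" "u = prod x u1 + v1"
              using VeqU unfolding V_def by blast
            obtain u2 v2 where 2: "u2 \<in> U" "v2 \<in> W" "u1 = (prod x ^^ i) u2 + v2"
              using Suc 1(1) by blast
            have "u = (prod x ^^ Suc i) u2 + (prod x v2 + v1)"
              using 1 2 by (simp add: prod_add_right)
            moreover have "prod x v2 + v1 \<in> W"
              using 1 2 invW subspace_add[OF subW] by blast
            ultimately show "\<exists>u'\<in>U. \<exists>v\<in>W. u = (prod x ^^ Suc i) u' + v"
              using 2(1) by blast
          qed
        qed
        obtain m where "\<forall>z\<in>lower_central 2. (prod x ^^ m) z = 0"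
          using prod_nilpotent_on_commutator by blast
        then have "U \<subseteq> W" using pow[of m] U(3) by fastforce
        then show False using WU by blast
      qed
      then have "P V" using subV invV VU by (auto simp: P_def stable_def)
      then have "W = V"
        using subspace_dim_equal[OF subW subV WV] max by blast
      moreover have "prod x u + 0 \<in> V" if "u \<in> U" for u
        using subspace_0[OF subW] that unfolding V_def by blast
      ultimately show "\<forall>u\<in>U. prod x u \<in> W" by simp
    qed
  qed
  then have "prod_span UNIV U \<subseteq> W"
    unfolding prod_span_def by (intro span_minimal subW) auto
  then have "dim (prod_span UNIV U) \<le> dim W" by (rule dim_subset)
  also have "dim W < dim U"
    using subspace_dim_equal[OF subW subU WU(1)] WU(2) by (meson not_le)
  finally show ?thesis .
qed

text \<open>The truncated subtraction fits the two cases: a nonzero member of the chain loses at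
  least one dimension in the next step, and a zero member stays zero.\<close>

lemma dim_descend_le:
  assumes "stable a" "a \<subseteq> lower_central 2"
  shows "dim (descend a i) \<le> dim a - i"
proof (induction i)
  case 0
  then show ?case by (simp add: descend_def)
next
  case (Suc i)
  let ?U = "descend a i"
  have st: "stable ?U" "?U \<subseteq> lower_central 2"
    using stable_descend assms by blast+
  have eq: "descend a (Suc i) = prod_span UNIV ?U" by (simp add: descend_def)
  show ?case
  proof (cases "?U = {0}")
    case True
    then have "descend a (Suc i) \<subseteq> {0}"
      using stable_prod_span(2)[OF st(1)] eq by simp
    then have "dim (descend a (Suc i)) = 0" by (simp only: dim_eq_0)
    then show ?thesis by (simp only: le0)
  next
    case False
    then show ?thesis using dim_prod_span_less[OF st(1) _ st(2)] Suc eq by simp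
  qed
qed

text \<open>The index \<open>Suc (t * (r - 1))\<close> reached by \<open>r\<close> factors is at
  least \<open>dim a\<close>, where the chain is 0. The bound \<open>2 \<le> t\<close> places
  \<open>a\<close> inside the commutator, where each \<open>L x\<close> is nilpotent; for
  \<open>t = 1\<close> the field itself with zero bracket and its own multiplication is a
  counterexample.\<close>

lemma L_pow_eq_0:
  assumes t: "2 \<le> t" and a: "characteristic_ideal a" "a \<subseteq> lower_central t"
    and r: "1 \<le> r" "dim a \<le> Suc (t * (r - 1))"
  shows "L_pow a r UNIV = {0}"
proof -
  have st: "stable a"
    using a(1) derivation_L
    by (auto simp: stable_def characteristic_ideal_def lie_ideal_def L_def image_subset_iff)
  have "dim (descend a (Suc (t * (r - 1)))) = 0"
    using dim_descend_le[OF st, of "Suc (t * (r - 1))"] a(2) lower_central_subset_2[OF t] r(2)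
    by (auto simp del: dim_eq_0)
  then have zero: "descend a (Suc (t * (r - 1))) \<subseteq> {0}" by (simp only: dim_eq_0)
  have "foldr L as x = 0" if "length as = r" "set as \<subseteq> a" for as x
  proof -
    have "foldr L as x \<in> descend a (Suc (t * (r - 1)))"
      using foldr_L_mem_descend[OF st a(2), of as x] that t r(1) by fastforce
    then show ?thesis using zero by blast
  qed
  then have "L_pow a r UNIV \<subseteq> span {0}"
    unfolding L_pow_def by (intro span_mono) auto
  moreover have "0 \<in> L_pow a r UNIV" by (simp add: L_pow_def span_zero)
  ultimately show ?thesis by auto
qed

end

text \<open>The ceiling is the least integer \<open>r\<close> with
  \<open>d + t - 1 \<le> t * r\<close>, which rearranges to the index bound. Positivity of
  \<open>r\<close> makes the natural subtraction \<open>r - 1\<close> faithful.\<close>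

lemma nat_ceiling_bound:
  fixes d t :: nat
  assumes "2 \<le> t"
  defines "r \<equiv> nat \<lceil>(real d + real t - 1) / real t\<rceil>"
  shows "1 \<le> r" "d \<le> Suc (t * (r - 1))"
proof -
  have "0 < (real d + real t - 1) / real t" using assms by simp
  then show r1: "1 \<le> r" unfolding r_def by linarith
  have "(real d + real t - 1) / real t \<le> real r" unfolding r_def by linarith
  then have "real d + real t - 1 \<le> real t * real r" using assms(1)
    by (simp add: divide_le_eq mult.commute)
  then have "real (d + t) \<le> real (Suc (t * r))" by simp
  then have "d + t \<le> Suc (t * r)" by (simp only: of_nat_le_iff)
  then show "d \<le> Suc (t * (r - 1))"
    using r1 by (cases r) auto
qed

section \<open>Assembly of the general bound and the stem case\<close>

theorem corollary3p4:
  fixes scale :: "'k::field_char_0 \<Rightarrow> 'g::ab_group_add \<Rightarrow> 'g"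
    and Basis :: "'g set"
    and bracket prod :: "'g \<Rightarrow> 'g \<Rightarrow> 'g"
  assumes findim: "finite_dimensional_vector_space scale Basis"
    and cpa: "cpa_structure scale bracket prod"
    and nilp: "lie_algebra.nilpotent scale bracket"
  shows "(\<forall>a t. 2 \<le> t \<longrightarrow>
            lie_algebra.characteristic_ideal scale bracket a \<longrightarrow>
            a \<subseteq> lie_algebra.lower_central scale bracket t \<longrightarrow>
            cpa_structure.L_pow scale prod a
              (nat \<lceil>(real (vector_space.dim scale a) + real t - 1) / real t\<rceil>) UNIV = {0}) \<and>
         (lie_algebra.stem scale bracket \<longrightarrow>
            cpa_structure.L_pow scale prod (lie_algebra.center bracket)
              (nat \<lceil>(real (vector_space.dim scale (lie_algebra.center bracket)) + 1) / 2\<rceil>) UNIV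
              = {0} \<and>
            (vector_space.dim scale (lie_algebra.center bracket) = 1 \<longrightarrow>
               cpa_structure.L_pow scale prod (lie_algebra.center bracket) 1 UNIV = {0} \<and>
               cpa_structure.prod_span scale prod UNIV (lie_algebra.center bracket) = {0}))"
proof -
  interpret cpa_structure scale bracket prod by (rule cpa)
  interpret finite_dimensional_vector_space scale Basis by (rule findim)
  interpret nilpotent_cpa scale bracket prod Basis
    by unfold_locales (rule nilp)
  have main: "L_pow a (nat \<lceil>(real (dim a) + real t - 1) / real t\<rceil>) UNIV = {0}"
    if "2 \<le> t" "characteristic_ideal a" "a \<subseteq> lower_central t" for a t
    using L_pow_eq_0[OF that] nat_ceiling_bound[OF that(1)] by blast
  have stem: "L_pow center (nat \<lceil>(real (dim center) + 1) / 2\<rceil>) UNIV = {0}" if stem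
    using main[OF order_refl characteristic_ideal_center] that by (simp add: stem_def add.commute)
  \<comment> \<open>For a center of dimension 1 the exponent is the ceiling of (1 + 1) / 2, which is
    1.\<close>
  have one: "L_pow center 1 UNIV = {0}" if stem "dim center = 1"
    using stem that by simp
  have span: "prod_span UNIV center = {0}" if stem "dim center = 1"
  proof -
    have "prod x z = 0" if z: "z \<in> center" for x z
    proof -
      \<comment> \<open>A one-element list exhibits \<open>prod z x\<close> as a generator of the
        vanishing span.\<close>
      have "foldr L [z] x \<in> L_pow center 1 UNIV"
        unfolding L_pow_def using z by (intro span_base CollectI exI[of _ "[z]"] exI[of _ x]) auto
      then show ?thesis
        using one[OF \<open>stem\<close> \<open>dim center = 1\<close>] by (simp add: L_def prod_commute)
    qed
    then have "prod_span UNIV center \<subseteq> span {0}"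
      unfolding prod_span_def by (intro span_mono) auto
    moreover have "0 \<in> prod_span UNIV center" by (simp add: prod_span_def span_zero)
    ultimately show ?thesis by auto
  qed
  show ?thesis
    by (intro conjI allI impI main stem one span)
qed

end
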